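(* Let $f:\mathcal H\to\mathbb R$ be continuously differentiable and $\mu$-strongly convex with $\mu>0$, and let $x^*$ be its unique minimizer. Suppose the non-negative perturbation parameters $\Delta_1,\Delta_2$ satisfy $$0\le\frac{\sqrt{\mu}}{2}\Delta_2\le\Delta_1 .$$ Then for any step size $s>0$ and any initial $x_0,v_0\in\mathcal H$, the sequence $(x_k,v_k)_{k\ge0}$ generated by the implicit scheme $$\frac{x_{k+1}-x_k}{\sqrt{s}}=v_{k+1},\qquad \frac{v_{k+1}-v_k}{\sqrt{s}}=-2\sqrt{\mu}\,v_{k+1}-(1+\Delta_1)\nabla f(x_{k+1})-\Delta_2\frac{\nabla f(x_{k+1})-\nabla f(x_k)}{\sqrt{s}}$$ satisfies $$f(x_k)-f(x^* )\le\frac{1}{1+\Delta_1}(1+\sqrt{\mu s})^{-k}E(0),\qquad\forall\,k\ge0,$$ where $$E(0)=(1+\Delta_1)(f(x_0)-f(x^* ))+\tfrac12\|v_0+\sqrt{\mu}(x_0-x^* )+\Delta_2\nabla f(x_0)\|^2 .$$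
   Context: $\mathcal H$ is a real finite-dimensional Hilbert space with inner product $\langle\cdot,\cdot\rangle$ and induced norm $\|\cdot\|$. A continuously differentiable $f$ is $\mu$-strongly convex if $f(y)-f(x)\ge\langle\nabla f(x),y-x\rangle+\frac{\mu}{2}\|y-x\|^2$ for all $x,y\in\mathcal H$. For general $k$ the paper's Lyapunov function is $E(k)=(1+\sqrt{\mu s})^k\big((1+\Delta_1)(f(x_k)-f(x^* ))+\frac12\|v_k+\sqrt\mu(x_k-x^* )+\Delta_2\nabla f(x_k)\|^2\big)$; only its value at $k=0$ enters the claim. *)

theory Defs
  imports "HOL-Analysis.Analysis"
begin

definition gradient :: "('a::real_inner \<Rightarrow> real) \<Rightarrow> 'a \<Rightarrow> 'a" where
  "gradient f x = (THE D. GDERIV f x :> D)"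

lemma gradient_eqI:
  assumes "GDERIV f x :> D"
  shows "gradient f x = D"
  unfolding gradient_def
proof (rule the_equality)
  show "GDERIV f x :> D" by (rule assms)
next
  fix D' assume "GDERIV f x :> D'"
  with assms have "(\<lambda>h. inner h D') = (\<lambda>h. inner h D)"
    unfolding gderiv_def using has_derivative_unique by blast
  then show "D' = D"
    by (metis vector_eq_ldot)
qed

(* Existence of the gradient vector at every point is equivalent to Frechet
   differentiability when the space is complete, in particular in finite dimension. *)
definition continuously_differentiable :: "('a::real_inner \<Rightarrow> real) \<Rightarrow> bool" where
  "continuously_differentiable f \<longleftrightarrow>
     (\<forall>x. \<exists>D. GDERIV f x :> D) \<and> continuous_on UNIV (gradient f)"

(* Meaningful for differentiable f only: gradient is unspecified elsewhere. *)
definition strongly_convex :: "real \<Rightarrow> ('a::real_inner \<Rightarrow> real) \<Rightarrow> bool" where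
  "strongly_convex \<mu> f \<longleftrightarrow>
     (\<forall>x y. f y - f x \<ge> inner (gradient f x) (y - x) + \<mu> / 2 * (norm (y - x))\<^sup>2)"

end

theory Submission
  imports Defs
begin

text \<open>
  Write \<open>m = sqrt \<mu>\<close>, \<open>h = sqrt s\<close>, and let \<open>W\<^sub>k = v\<^sub>k + m (x\<^sub>k - x\<^sup>*) + \<Delta>\<^sub>2 \<nabla>f(x\<^sub>k)\<close> be the vector
  whose squared norm enters the Lyapunov function.  The coefficients of \<open>W\<close> are chosen so that the
  difference of gradients in the scheme is absorbed: one step moves it by
  \<open>W\<^sub>k\<^sub>+\<^sub>1 - W\<^sub>k = - h (m v\<^sub>k\<^sub>+\<^sub>1 + (1 + \<Delta>\<^sub>1) \<nabla>f(x\<^sub>k\<^sub>+\<^sub>1))\<close>.  Both terms of the energy are therefore compared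
  at the new point only: strong convexity, based at \<open>x\<^sub>k\<^sub>+\<^sub>1\<close>, bounds \<open>f(x\<^sub>k)\<close> from below and
  \<open>f(x\<^sub>k\<^sub>+\<^sub>1) - f(x\<^sup>*)\<close> from above.  After these substitutions the terms of second order in \<open>h\<close> are
  squares with a favourable sign, whatever the step size, and the terms of first order form a quadratic
  form in \<open>v\<^sub>k\<^sub>+\<^sub>1\<close>, \<open>x\<^sub>k\<^sub>+\<^sub>1 - x\<^sup>*\<close> and \<open>\<nabla>f(x\<^sub>k\<^sub>+\<^sub>1)\<close>, which is a sum of squares because
  \<open>m \<Delta>\<^sub>2 / 2 \<le> \<Delta>\<^sub>1\<close> (lemma \<open>lyapunov_quadratic_form\<close>).  This gives contraction of the energy by the
  factor \<open>1 / (1 + m h)\<close> in every step (lemma \<open>energy_contraction\<close>), and the claim follows by iterating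
  and discarding the squared norm.
\<close>

definition energy :: "('a::real_inner \<Rightarrow> real) \<Rightarrow> real \<Rightarrow> real \<Rightarrow> real \<Rightarrow> 'a \<Rightarrow> 'a \<Rightarrow> 'a \<Rightarrow> real" where
  "energy f m a d z x v =
     a * (f x - f z) + 1 / 2 * (norm (v + m *\<^sub>R (x - z) + d *\<^sub>R gradient f x))\<^sup>2"

text \<open>
  This is the part of the energy balance that is linear in the step size; \<open>y\<close> and \<open>g\<close> stand for
  \<open>x\<^sub>k\<^sub>+\<^sub>1 - x\<^sup>*\<close> and \<open>\<nabla>f(x\<^sub>k\<^sub>+\<^sub>1)\<close>.  The only indefinite term left in the difference of the two sides
  is \<open>- m\<^sup>2 d \<langle>g, y\<rangle>\<close>.  A share \<open>m d / 2\<close> of \<open>D\<close> supplies the multiple of \<open>\<parallel>y\<parallel>\<^sup>2\<close> that completes it to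
  \<open>d \<parallel>g - (m\<^sup>2 / 2) y\<parallel>\<^sup>2\<close>, and also cancels the \<open>d\<^sup>2 \<parallel>g\<parallel>\<^sup>2\<close> coming from the norm on the left.
\<close>

lemma lyapunov_quadratic_form:
  fixes v y g :: "'a::real_inner"
  assumes "m \<ge> 0" "d \<ge> 0" "m / 2 * d \<le> D"
  shows "m * ((1 + D) * (inner g y - m\<^sup>2 / 2 * (norm y)\<^sup>2)
              + 1 / 2 * (norm (v + m *\<^sub>R y + d *\<^sub>R g))\<^sup>2)
         \<le> inner (v + m *\<^sub>R y + d *\<^sub>R g) (m *\<^sub>R v + (1 + D) *\<^sub>R g) - (1 + D) * inner g v"
    (is "?L \<le> ?R")
proof -
  have "?R - ?L = m / 2 * (norm v)\<^sup>2
      + (D - m / 2 * d) * (m ^ 3 / 2 * (norm y)\<^sup>2 + d * (norm g)\<^sup>2)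
      + d * (norm (g - (m\<^sup>2 / 2) *\<^sub>R y))\<^sup>2"
    unfolding power2_norm_eq_inner
    by (simp only: inner_add_left inner_add_right inner_diff_left inner_diff_right
        inner_scaleR_left inner_scaleR_right
        inner_commute[of y g] inner_commute[of v g] inner_commute[of y v])
       (simp add: algebra_simps power2_eq_square power3_eq_cube
        add_divide_distrib diff_divide_distrib)
  also have "\<dots> \<ge> 0"
    using assms by (intro add_nonneg_nonneg mult_nonneg_nonneg) auto
  finally show ?thesis by simp
qed

text \<open>
  Expanding the squared norm around the new vector \<open>W\<^sub>k\<^sub>+\<^sub>1\<close> rather than around \<open>W\<^sub>k\<close> makes the quadratic
  remainder help the decrease; this is what the implicit discretisation buys, and why no restriction
  on \<open>h\<close> appears.
\<close>

lemma energy_contraction: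
  fixes f :: "'a::real_inner \<Rightarrow> real"
  assumes strong: "strongly_convex (m\<^sup>2) f"
    and m: "m \<ge> 0" and h: "h > 0" and d: "d \<ge> 0" "m / 2 * d \<le> D"
    and x_step: "(x' - x) /\<^sub>R h = v'"
    and v_step: "(v' - v) /\<^sub>R h = - (2 * m) *\<^sub>R v' - (1 + D) *\<^sub>R gradient f x'
          - d *\<^sub>R ((gradient f x' - gradient f x) /\<^sub>R h)"
  shows "(1 + m * h) * energy f m (1 + D) d z x' v' \<le> energy f m (1 + D) d z x v"
proof -
  define a where "a = 1 + D"
  define g where "g = gradient f x'"
  define y where "y = x' - z"
  define W where "W = v' + m *\<^sub>R y + d *\<^sub>R g"
  define r where "r = m *\<^sub>R v' + a *\<^sub>R g"
  have "0 \<le> m / 2 * d"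
    using m d by simp
  then have a: "a \<ge> 0"
    using d unfolding a_def by linarith
  have x': "x' - x = h *\<^sub>R v'"
    using x_step h by auto
  have "v' - v = h *\<^sub>R ((v' - v) /\<^sub>R h)"
    using h by simp
  also have "\<dots> = - (2 * m * h) *\<^sub>R v' - (h * a) *\<^sub>R g - d *\<^sub>R (g - gradient f x)"
    unfolding v_step a_def g_def using h by (simp add: scaleR_right_diff_distrib field_simps)
  finally have v: "v = v' + (2 * m * h) *\<^sub>R v' + (h * a) *\<^sub>R g + d *\<^sub>R (g - gradient f x)"
    by (simp add: algebra_simps)
  have twice: "(2 * m * h) *\<^sub>R v' = (m * h) *\<^sub>R v' + (m * h) *\<^sub>R v'"
    by (simp flip: scaleR_left_distrib)
  have x_z: "x - z = y - h *\<^sub>R v'"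
    using x' by (simp add: y_def algebra_simps)
  have W_step: "v + m *\<^sub>R (x - z) + d *\<^sub>R gradient f x = W + h *\<^sub>R r"
    unfolding x_z v twice by (simp add: W_def r_def algebra_simps)
  have "f x - f x' \<ge> inner g (x - x') + m\<^sup>2 / 2 * (norm (x - x'))\<^sup>2"
    using strong unfolding strongly_convex_def g_def by blast
  moreover have "x - x' = - (h *\<^sub>R v')"
    using x' by (simp add: algebra_simps)
  ultimately have f_decrease: "f x - f x' \<ge> - h * inner g v'"
    by (simp add: add_increasing2 order_trans[rotated])
  have "f z - f x' \<ge> inner g (z - x') + m\<^sup>2 / 2 * (norm (z - x'))\<^sup>2"
    using strong unfolding strongly_convex_def g_def by blast
  moreover have "z - x' = - y"
    by (simp add: y_def)
  ultimately have f_gap: "f x' - f z \<le> inner g y - m\<^sup>2 / 2 * (norm y)\<^sup>2"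
    by simp
  have "(norm (W + h *\<^sub>R r))\<^sup>2 = (norm W)\<^sup>2 + 2 * h * inner W r + h\<^sup>2 * (norm r)\<^sup>2"
    unfolding power2_norm_eq_inner
    by (simp add: inner_add_left inner_add_right inner_commute[of r W] power2_eq_square
        algebra_simps)
  also have "\<dots> \<ge> (norm W)\<^sup>2 + 2 * h * inner W r"
    by simp
  finally have norm_W: "(norm (W + h *\<^sub>R r))\<^sup>2 \<ge> (norm W)\<^sup>2 + 2 * h * inner W r" .
  have "m * (a * (f x' - f z) + 1 / 2 * (norm W)\<^sup>2)
      \<le> m * (a * (inner g y - m\<^sup>2 / 2 * (norm y)\<^sup>2) + 1 / 2 * (norm W)\<^sup>2)"
    using m a f_gap by (intro mult_left_mono add_mono) auto
  also have "\<dots> \<le> inner W r - a * inner g v'"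
    unfolding a_def W_def r_def using lyapunov_quadratic_form[OF m d] .
  finally have "h * (m * (a * (f x' - f z) + 1 / 2 * (norm W)\<^sup>2))
      \<le> h * (inner W r - a * inner g v')"
    using h by (intro mult_left_mono) auto
  moreover have "a * (f x - f x') \<ge> a * (- h * inner g v')"
    using a f_decrease by (rule mult_left_mono[rotated])
  ultimately have "(1 + m * h) * (a * (f x' - f z) + 1 / 2 * (norm W)\<^sup>2)
      \<le> a * (f x - f z) + 1 / 2 * (norm (W + h *\<^sub>R r))\<^sup>2"
    using norm_W by (simp add: algebra_simps add_divide_distrib)
  then show ?thesis
    unfolding energy_def W_step a_def[symmetric] g_def[symmetric] y_def[symmetric]
      W_def[symmetric] .
qed

theorem theorem3:
  fixes f :: "'a::real_inner \<Rightarrow> real"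
    and xstar :: 'a
    and \<mu> s \<Delta>\<^sub>1 \<Delta>\<^sub>2 :: real
    and x\<^sub>0 v\<^sub>0 :: 'a
    and x v :: "nat \<Rightarrow> 'a"
    and E\<^sub>0 :: real
  assumes finite_dim: "\<exists>B. finite B \<and> span B = (UNIV :: 'a set)"
    and C1: "continuously_differentiable f"
    and mu_pos: "\<mu> > 0"
    and strong: "strongly_convex \<mu> f"
    and minimizer: "is_arg_min f (\<lambda>_. True) xstar"
    and Delta_nonneg: "\<Delta>\<^sub>1 \<ge> 0" "\<Delta>\<^sub>2 \<ge> 0"
    and Delta: "0 \<le> sqrt \<mu> / 2 * \<Delta>\<^sub>2" "sqrt \<mu> / 2 * \<Delta>\<^sub>2 \<le> \<Delta>\<^sub>1"
    and step: "s > 0"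
    and init: "x 0 = x\<^sub>0" "v 0 = v\<^sub>0"
    and scheme_x: "\<And>k. (x (Suc k) - x k) /\<^sub>R sqrt s = v (Suc k)"
    and scheme_v: "\<And>k. (v (Suc k) - v k) /\<^sub>R sqrt s =
          - (2 * sqrt \<mu>) *\<^sub>R v (Suc k)
          - (1 + \<Delta>\<^sub>1) *\<^sub>R gradient f (x (Suc k))
          - \<Delta>\<^sub>2 *\<^sub>R ((gradient f (x (Suc k)) - gradient f (x k)) /\<^sub>R sqrt s)"
  defines "E\<^sub>0 \<equiv> (1 + \<Delta>\<^sub>1) * (f x\<^sub>0 - f xstar)
          + 1 / 2 * (norm (v\<^sub>0 + sqrt \<mu> *\<^sub>R (x\<^sub>0 - xstar) + \<Delta>\<^sub>2 *\<^sub>R gradient f x\<^sub>0))\<^sup>2"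
  shows "\<forall>k. f (x k) - f xstar \<le> 1 / (1 + \<Delta>\<^sub>1) * (1 + sqrt (\<mu> * s)) powi (- int k) * E\<^sub>0"
proof
  fix k
  define m where "m = sqrt \<mu>"
  define h where "h = sqrt s"
  define E where "E k = energy f m (1 + \<Delta>\<^sub>1) \<Delta>\<^sub>2 xstar (x k) (v k)" for k
  have m: "m \<ge> 0" "m\<^sup>2 = \<mu>" and h: "h > 0"
    using mu_pos step by (simp_all add: m_def h_def)
  have contraction: "(1 + m * h) * E (Suc n) \<le> E n" for n
    unfolding E_def
    using energy_contraction[OF _ m(1) h Delta_nonneg(2) _ scheme_x[of n, folded h_def]
        scheme_v[of n, folded h_def m_def]] strong m(2) Delta(2)
    by (simp add: m_def)
  have q: "1 + m * h > 0"
    using m h by (simp add: add_pos_nonneg)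
  have iterate: "(1 + m * h) ^ n * E n \<le> E 0" for n
  proof (induction n)
    case (Suc n)
    have "(1 + m * h) ^ Suc n * E (Suc n) = (1 + m * h) ^ n * ((1 + m * h) * E (Suc n))"
      by (simp add: algebra_simps)
    also have "\<dots> \<le> (1 + m * h) ^ n * E n"
      using contraction q by (intro mult_left_mono) auto
    finally show ?case using Suc.IH by simp
  qed simp
  have E0: "E 0 = E\<^sub>0"
    by (simp add: E_def E\<^sub>0_def energy_def init m_def)
  have "(1 + \<Delta>\<^sub>1) * (f (x k) - f xstar) \<le> E k"
    by (simp add: E_def energy_def)
  also have "E k \<le> E\<^sub>0 / (1 + m * h) ^ k"
    using iterate[of k] q by (simp add: E0 pos_le_divide_eq mult.commute)
  finally have "f (x k) - f xstar \<le> E\<^sub>0 / (1 + m * h) ^ k / (1 + \<Delta>\<^sub>1)"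
    using Delta_nonneg(1) by (subst pos_le_divide_eq) (simp_all add: mult.commute)
  also have "\<dots> = 1 / (1 + \<Delta>\<^sub>1) * (1 + sqrt (\<mu> * s)) powi (- int k) * E\<^sub>0"
    by (simp add: m_def h_def real_sqrt_mult power_int_minus field_simps)
  finally show "f (x k) - f xstar
      \<le> 1 / (1 + \<Delta>\<^sub>1) * (1 + sqrt (\<mu> * s)) powi (- int k) * E\<^sub>0" .
qed

end
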